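(* Let $\sigma$ be a permutation of length two or more. Then $\sigma$ is not effective if and only if $\hat{\sigma}=1\oplus\alpha$ for some $\alpha\in\mathrm{Sym}(231)$.
   Context: $\mathrm{Sym}_n$ is the set of permutations of $\{1,\dots,n\}$ in one-line notation and $\mathrm{Sym}=\bigcup_{n\ge 1}\mathrm{Sym}_n$. A sequence of distinct numbers contains a permutation $\tau$ of length $k$ if it has a (not necessarily contiguous) subsequence of length $k$ that is order isomorphic to $\tau$; otherwise it avoids $\tau$. $\mathrm{Sym}(\tau)$ denotes the set of permutations in $\mathrm{Sym}$ avoiding $\tau$. For $\sigma=\sigma_1\sigma_2\sigma_3\cdots\sigma_k$ with $k\ge2$, $\hat\sigma=\sigma_2\sigma_1\sigma_3\cdots\sigma_k$ (interchange the first two entries). For a permutation $\alpha=\alpha_1\cdots\alpha_m$, $1\oplus\alpha$ is the permutation $1(\alpha_1+1)\cdots(\alpha_m+1)$ of length $m+1$. For a permutation $\tau$ of length at least two, the $\tau$-stack operator $\mathcal{S}^{\tau}:\mathrm{Sym}\to\mathrm{Sym}$ sends $\pi$ to the output of the following greedy process, starting with an empty stack and an empty output. While there are unread entries of $\pi$ (read from left to right): if pushing the next entry on top of the stack yields stack content that, read from top to bottom, avoids $\tau$, push it; otherwise pop the top entry of the stack and append it to the right end of the output. When all entries of $\pi$ have been read, pop all remaining entries of the stack one by one, appending them to the output. A permutation $\pi\in\mathrm{Sym}_n$ is $\sigma$-sortable if $(\mathcal{S}^{21}\circ\mathcal{S}^{\sigma})(\pi)=12\cdots n$; $\mathrm{Sort}(\sigma)$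 is the set of $\sigma$-sortable permutations. The set of $\sigma$-sorted permutations is $\mathrm{Sorted}(\sigma)=\mathcal{S}^{\sigma}(\mathrm{Sort}(\sigma))$. The permutation $\sigma$ is effective if $\mathrm{Sorted}(\sigma)\subseteq\mathrm{Sym}(\sigma)$. *)

theory Defs
  imports Main "HOL-Library.Sublist"
begin

definition Sym_n :: "nat \<Rightarrow> nat list set" where
  "Sym_n n = {\<pi>. length \<pi> = n \<and> distinct \<pi> \<and> set \<pi> = {1..n}}"

definition Sym :: "nat list set" where
  "Sym = (\<Union>n\<in>{1..}. Sym_n n)"

definition order_iso :: "nat list \<Rightarrow> nat list \<Rightarrow> bool" where
  "order_iso xs ys \<longleftrightarrow> length xs = length ys \<and>
     (\<forall>i < length xs. \<forall>j < length xs. xs ! i < xs ! j \<longleftrightarrow> ys ! i < ys ! j)"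

definition contains :: "nat list \<Rightarrow> nat list \<Rightarrow> bool" where
  "contains xs \<tau> \<longleftrightarrow> (\<exists>ys. subseq ys xs \<and> order_iso ys \<tau>)"

abbreviation avoids :: "nat list \<Rightarrow> nat list \<Rightarrow> bool" where
  "avoids xs \<tau> \<equiv> \<not> contains xs \<tau>"

definition Sym_av :: "nat list \<Rightarrow> nat list set" where
  "Sym_av \<tau> = {\<pi> \<in> Sym. avoids \<pi> \<tau>}"

fun hat :: "nat list \<Rightarrow> nat list" where
  "hat (a # b # xs) = b # a # xs"
| "hat xs = xs"

definition one_oplus :: "nat list \<Rightarrow> nat list" where
  "one_oplus \<alpha> = 1 # map Suc \<alpha>"

(* stack_run tau inp stk is the output still to be produced when inp is the unread input and
   stk is the stack content listed from top to bottom.  When length tau >= 2, a push onto the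
   empty stack is always allowed, so the second equation needs no test. *)
fun stack_run :: "nat list \<Rightarrow> nat list \<Rightarrow> nat list \<Rightarrow> nat list" where
  "stack_run \<tau> [] stk = stk"
| "stack_run \<tau> (x # inp) [] = stack_run \<tau> inp [x]"
| "stack_run \<tau> (x # inp) (y # stk) =
     (if avoids (x # y # stk) \<tau> then stack_run \<tau> inp (x # y # stk)
      else y # stack_run \<tau> (x # inp) stk)"

definition stack_op :: "nat list \<Rightarrow> nat list \<Rightarrow> nat list" where
  "stack_op \<tau> \<pi> = stack_run \<tau> \<pi> []"

definition sortable :: "nat list \<Rightarrow> nat list \<Rightarrow> bool" where
  "sortable \<sigma> \<pi> \<longleftrightarrow> \<pi> \<in> Sym \<and> (stack_op [2, 1] \<circ> stack_op \<sigma>) \<pi> = [1..<Suc (length \<pi>)]"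

definition Sort :: "nat list \<Rightarrow> nat list set" where
  "Sort \<sigma> = {\<pi>. sortable \<sigma> \<pi>}"

definition Sorted :: "nat list \<Rightarrow> nat list set" where
  "Sorted \<sigma> = stack_op \<sigma> ` Sort \<sigma>"

definition effective :: "nat list \<Rightarrow> bool" where
  "effective \<sigma> \<longleftrightarrow> Sorted \<sigma> \<subseteq> Sym_av \<sigma>"

end

theory Submission imports Defs "HOL-Library.Multiset"
begin

text \<open>
  By Knuth's theorem a permutation is \<open>\<sigma>\<close>-sortable iff its image under the \<open>\<sigma>\<close>-stack avoids 231,
  so \<open>\<sigma>\<close> is not effective iff some output \<open>\<rho>\<close> of the \<open>\<sigma>\<close>-stack avoids 231 and contains \<open>\<sigma>\<close>.
  Without a forced pop \<open>\<rho>\<close> is the reversed input and avoids \<open>\<sigma>\<close>; the last of the pops forced by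
  an entry \<open>x\<close> puts the popped entry before \<open>x\<close>, which turns an occurrence of \<open>\<sigma>\<close> into one of \<open>hat \<sigma>\<close>
  in \<open>\<rho>\<close>. Hence both \<open>\<sigma>\<close> and \<open>hat \<sigma>\<close> avoid 231, so that 1 is one of the first two entries of \<open>\<sigma>\<close>. If it
  is the first one, then an output avoiding 231 also avoids \<open>\<sigma>\<close>.

  Conversely, let \<open>\<sigma> = a 1 s\<close> with \<open>a s\<close> avoiding 231. Then \<open>s = s1 s2\<close> with all entries of \<open>s1\<close> below
  and all of \<open>s2\<close> above \<open>a\<close>. For a copy \<open>x t\<close> of \<open>a s\<close> lying above \<open>a\<close>, the input \<open>rev t, a, x, rev s1, 1\<close>
  has output \<open>a 1 s1 x t\<close>: only \<open>a\<close> is popped early, by \<open>x\<close>. The output avoids 231, and \<open>a 1 s1\<close>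
  together with the part of \<open>t\<close> that corresponds to \<open>s2\<close> is an occurrence of \<open>\<sigma>\<close>.
\<close>

section \<open>Order isomorphism and containment\<close>

text \<open>Pairing corresponding entries removes the indices: taking subsequences and reordering
  become operations on \<open>zs\<close>, and the condition depends only on
  \<open>set zs\<close>.\<close>

lemma order_iso_zip_iff:
  "order_iso xs ys \<longleftrightarrow> (\<exists>zs. xs = map fst zs \<and> ys = map snd zs \<and>
     (\<forall>p\<in>set zs. \<forall>q\<in>set zs. fst p < fst q \<longleftrightarrow> snd p < snd q))" (is "_ \<longleftrightarrow> ?R")
proof
  assume iso: "order_iso xs ys"
  hence "xs = map fst (zip xs ys)" "ys = map snd (zip xs ys)"
    by (simp_all add: order_iso_def)
  moreover have "\<forall>p\<in>set (zip xs ys). \<forall>q\<in>set (zip xs ys). fst p < fst q \<longleftrightarrow> snd p < snd q"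
    using iso by (auto simp: order_iso_def set_zip)
  ultimately show ?R by blast
next
  assume ?R
  thus "order_iso xs ys" by (auto simp: order_iso_def)
qed

lemma order_iso_sym: "order_iso xs ys \<Longrightarrow> order_iso ys xs"
  by (auto simp: order_iso_def)

lemma order_iso_trans: "order_iso xs ys \<Longrightarrow> order_iso ys zs \<Longrightarrow> order_iso xs zs"
  by (auto simp: order_iso_def)

lemma order_iso_map:
  assumes "strict_mono_on (set xs) f"
  shows "order_iso (map f xs) xs"
  using assms by (auto simp: order_iso_def strict_mono_on_less)

lemma order_iso_swap:
  assumes "order_iso (x # y # xs) (u # v # ys)"
  shows "order_iso (y # x # xs) (v # u # ys)"
proof -
  from assms obtain p q zs where "x = fst p" "y = fst q" "xs = map fst zs"
    "u = snd p" "v = snd q" "ys = map snd zs"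
    "\<forall>a\<in>set (p # q # zs). \<forall>b\<in>set (p # q # zs). fst a < fst b \<longleftrightarrow> snd a < snd b"
    unfolding order_iso_zip_iff by (auto simp: Cons_eq_map_conv)
  thus ?thesis unfolding order_iso_zip_iff
    by (intro exI[of _ "q # p # zs"]) auto
qed

text \<open>When the pattern begins with its minimum, the first entry of an occurrence can be
  exchanged for any other value below the remaining entries.\<close>

lemma order_iso_Cons_min:
  assumes "\<forall>v\<in>set ys. y < v"
  shows "order_iso (x # xs) (y # ys) \<longleftrightarrow> order_iso xs ys \<and> (\<forall>u\<in>set xs. x < u)"
    (is "?L \<longleftrightarrow> ?R")
proof
  assume ?L
  then obtain p zs where *: "x = fst p" "xs = map fst zs" "y = snd p" "ys = map snd zs"
    "\<forall>a\<in>set (p # zs). \<forall>b\<in>set (p # zs). fst a < fst b \<longleftrightarrow> snd a < snd b"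
    unfolding order_iso_zip_iff by (auto simp: Cons_eq_map_conv)
  hence "order_iso xs ys" unfolding order_iso_zip_iff by auto
  moreover have "\<forall>u\<in>set xs. x < u" using * assms by auto
  ultimately show ?R by blast
next
  assume R: ?R
  then obtain zs where *: "xs = map fst zs" "ys = map snd zs"
    "\<forall>a\<in>set zs. \<forall>b\<in>set zs. fst a < fst b \<longleftrightarrow> snd a < snd b"
    unfolding order_iso_zip_iff by auto
  have "\<forall>b\<in>set zs. x < fst b \<and> y < snd b" using R assms * by auto
  with * show ?L unfolding order_iso_zip_iff
    by (intro exI[of _ "(x, y) # zs"]) (auto dest: less_asym)
qed

text \<open>Every value from 1 to \<open>y\<close> occurs in the pattern. Going up through these
  values, the counterparts increase strictly and start at 1 or more.\<close>

lemma order_iso_perm_hd_le: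
  assumes iso: "order_iso (x # xs) (y # ys)" and set: "set (y # ys) = {1..n}"
    and pos: "\<forall>u\<in>set (x # xs). 1 \<le> u"
  shows "y \<le> x"
proof -
  from iso obtain zs where zs: "x # xs = map fst zs" "y # ys = map snd zs"
    "\<forall>p\<in>set zs. \<forall>q\<in>set zs. fst p < fst q \<longleftrightarrow> snd p < snd q"
    unfolding order_iso_zip_iff by (elim exE conjE) (rule that)
  have setz: "snd ` set zs = {1..n}" and posz: "\<forall>p\<in>set zs. 1 \<le> fst p"
    using set pos unfolding zs(1,2) by auto
  have le: "v \<le> u" if "(u, v) \<in> set zs" for u v
    using that
  proof (induction v arbitrary: u)
    case (Suc v)
    show ?case
    proof (cases "v = 0")
      case True
      thus ?thesis using posz Suc.prems by force
    next
      case False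
      have "Suc v \<in> {1..n}" using setz Suc.prems by force
      with False have "v \<in> snd ` set zs" using setz by auto
      then obtain w where w: "(w, v) \<in> set zs" by auto
      with zs(3) Suc.prems have "w < u" by fastforce
      with Suc.IH[OF w] show ?thesis by simp
    qed
  qed simp
  from zs obtain p where "x = fst p" "y = snd p" "p \<in> set zs"
    by (auto simp: Cons_eq_map_conv)
  thus ?thesis using le[of x y] by simp
qed

lemma contains_mono: "contains xs \<tau> \<Longrightarrow> subseq xs ys \<Longrightarrow> contains ys \<tau>"
  unfolding contains_def by (meson subseq_order.trans)

lemma contains_length: "contains xs \<tau> \<Longrightarrow> length \<tau> \<le> length xs"
  unfolding contains_def order_iso_def by (metis list_emb_length)

lemma contains_order_iso: "contains xs \<tau> \<Longrightarrow> order_iso xs ys \<Longrightarrow> contains ys \<tau>"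
proof -
  assume "contains xs \<tau>" and "order_iso xs ys"
  then obtain us zs where us: "subseq us (map fst zs)" "order_iso us \<tau>"
    and zs: "xs = map fst zs" "ys = map snd zs"
      "\<forall>p\<in>set zs. \<forall>q\<in>set zs. fst p < fst q \<longleftrightarrow> snd p < snd q"
    unfolding contains_def order_iso_zip_iff[of xs ys] by auto
  \<comment> \<open>One index set selects the corresponding entries of both lists.\<close>
  from us(1) obtain N where "us = nths (map fst zs) N"
    unfolding subseq_conv_nths by auto
  hence us_eq: "us = map fst (nths zs N)" by (simp add: nths_map)
  have "set (nths zs N) \<subseteq> set zs" by (rule set_nths_subset)
  hence "order_iso us (map snd (nths zs N))"
    unfolding order_iso_zip_iff us_eq using zs(3)
    by (intro exI[of _ "nths zs N"]) blast
  moreover have "subseq (map snd (nths zs N)) ys"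
    unfolding zs(2) by (intro subseq_map) (auto simp: subseq_conv_nths)
  ultimately show "contains ys \<tau>"
    unfolding contains_def using us(2) order_iso_sym order_iso_trans by blast
qed

lemma contains_trans: "contains xs \<tau> \<Longrightarrow> contains \<tau> \<upsilon> \<Longrightarrow> contains xs \<upsilon>"
  by (meson contains_def contains_mono contains_order_iso order_iso_sym)

lemma all_less_Suc3: "(\<forall>i<Suc (Suc (Suc 0)). P i) \<longleftrightarrow> P 0 \<and> P 1 \<and> P 2"
  by (auto simp: less_Suc_eq numeral_2_eq_2)

lemma set_subseq: "subseq xs ys \<Longrightarrow> set xs \<subseteq> set ys"
  by (auto simp: subseq_conv_nths dest: in_set_nthsD)

lemma sorted_wrt_subseq: "subseq xs ys \<Longrightarrow> sorted_wrt P ys \<Longrightarrow> sorted_wrt P xs"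
  by (induction rule: list_emb.induct) (auto dest: set_subseq)

section \<open>The patterns 21 and 231\<close>

lemma contains_21_iff: "contains xs [2, 1] \<longleftrightarrow> \<not> sorted xs"
proof
  assume "contains xs [2, 1]"
  then obtain ys where ys: "subseq ys xs" "order_iso ys [2, 1]" by (auto simp: contains_def)
  then obtain u v where "ys = [u, v]" "v < u"
    by (auto simp: order_iso_def length_Suc_conv All_less_Suc2)
  with ys(1) show "\<not> sorted xs"
    using sorted_wrt_subseq by fastforce
next
  assume "\<not> sorted xs"
  thus "contains xs [2, 1]"
  proof (induction xs)
    case (Cons x xs)
    show ?case
    proof (cases "sorted xs")
      case True
      with Cons.prems obtain y where "y \<in> set xs" "y < x" by force
      hence "subseq [x, y] (x # xs)" "order_iso [x, y] [2, 1]"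
        by (auto simp: order_iso_def All_less_Suc2 subseq_singleton_left)
      thus ?thesis by (auto simp: contains_def)
    next
      case False
      thus ?thesis using Cons.IH contains_mono[of xs _ "x # xs"] by auto
    qed
  qed simp
qed

lemma contains_231_iff:
  "contains xs [2, 3, 1] \<longleftrightarrow> (\<exists>u v w. subseq [u, v, w] xs \<and> w < u \<and> u < v)"
proof
  assume "contains xs [2, 3, 1]"
  then obtain ys where ys: "subseq ys xs" "order_iso ys [2, 3, 1]" by (auto simp: contains_def)
  then obtain u v w where "ys = [u, v, w]" "w < u" "u < v"
    by (auto simp: order_iso_def length_Suc_conv all_less_Suc3)
  with ys(1) show "\<exists>u v w. subseq [u, v, w] xs \<and> w < u \<and> u < v" by blast
next
  assume "\<exists>u v w. subseq [u, v, w] xs \<and> w < u \<and> u < v"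
  then obtain u v w where *: "subseq [u, v, w] xs" "w < u" "u < v" by blast
  hence "order_iso [u, v, w] [2, 3, 1]" by (auto simp: order_iso_def all_less_Suc3)
  with * show "contains xs [2, 3, 1]" by (auto simp: contains_def)
qed

lemma contains_231I:
  "subseq [u, v, w] xs \<Longrightarrow> w < u \<Longrightarrow> u < v \<Longrightarrow> contains xs [2, 3, 1]"
  unfolding contains_231_iff by blast

lemma subseq_append_not_in:
  "subseq (x # xs) (ys @ zs) \<Longrightarrow> x \<notin> set ys \<Longrightarrow> subseq (x # xs) zs"
  by (induction ys) (auto elim: list_emb.cases)

text \<open>A 231 meeting both lists would have its first entry in \<open>xs\<close> and its last in
  \<open>ys\<close>, although the last is the smaller one.\<close>

lemma avoids_231_append:
  assumes "avoids xs [2, 3, 1]" "avoids ys [2, 3, 1]" "\<forall>x\<in>set xs. \<forall>y\<in>set ys. x < y"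
  shows "avoids (xs @ ys) [2, 3, 1]"
proof
  assume "contains (xs @ ys) [2, 3, 1]"
  then obtain u v w where uvw: "subseq [u, v, w] (xs @ ys)" "w < u" "u < v"
    unfolding contains_231_iff by blast
  then obtain as bs where split: "[u, v, w] = as @ bs" "subseq as xs" "subseq bs ys"
    by (auto simp: subseq_append_iff)
  from split(1) consider "bs = [u, v, w]" | "as = [u, v, w]" | "u \<in> set as" "w \<in> set bs"
    by (auto simp: Cons_eq_append_conv)
  thus False
  proof cases
    case 3
    hence "u \<in> set xs" "w \<in> set ys" using split(2,3)[THEN set_subseq] by auto
    with assms(3) uvw(2) show False using less_asym by blast
  qed (use assms split uvw contains_231I in \<open>blast+\<close>)
qed

section \<open>The stack operator\<close>

lemma mset_stack_run: "mset (stack_run \<tau> inp stk) = mset inp + mset stk"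
  by (induction \<tau> inp stk rule: stack_run.induct) auto

lemma set_stack_run: "set (stack_run \<tau> inp stk) = set inp \<union> set stk"
  using mset_stack_run[of \<tau> inp stk] by (metis mset_append set_append set_mset_mset)

lemma length_stack_run: "length (stack_run \<tau> inp stk) = length inp + length stk"
  using mset_stack_run[of \<tau> inp stk] by (metis size_mset size_union)

lemma subseq_stack_run: "subseq stk (stack_run \<tau> inp stk)"
proof (induction \<tau> inp stk rule: stack_run.induct)
  case (3 \<tau> x inp y stk)
  thus ?case using subseq_Cons'[of x "y # stk"] by simp
qed simp_all

text \<open>Each stack met while reading \<open>xs\<close> is a suffix of
  \<open>rev xs @ stk\<close>, so no push is refused.\<close>

lemma stack_run_push:
  assumes "avoids (rev xs @ stk) \<tau>"
  shows "stack_run \<tau> (xs @ inp) stk = stack_run \<tau> inp (rev xs @ stk)"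
  using assms
proof (induction xs arbitrary: stk)
  case (Cons x xs)
  have "avoids (x # stk) \<tau>"
    using Cons.prems contains_mono[of "x # stk" \<tau> "rev (x # xs) @ stk"] by auto
  hence "stack_run \<tau> ((x # xs) @ inp) stk = stack_run \<tau> (xs @ inp) (x # stk)"
    by (cases stk) auto
  with Cons show ?case by simp
qed simp

section \<open>Knuth's theorem on stack sorting\<close>

text \<open>The induction needs an arbitrary sorted stack: it behaves as if its entries, from bottom
  to top, still stood in front of the input.\<close>

lemma sorted_stack_run_21_iff:
  "sorted stk \<Longrightarrow> sorted (stack_run [2, 1] inp stk) \<longleftrightarrow> avoids (rev stk @ inp) [2, 3, 1]"
proof (induction "[2, 1] :: nat list" inp stk rule: stack_run.induct)
  case (1 stk)
  have False if "subseq [u, v, w] (rev stk)" "w < u" "u < v" for u v w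
  proof -
    from that(1) have "sorted_wrt (\<ge>) [u, v, w]"
      using 1 by (intro sorted_wrt_subseq[OF that(1)]) (simp add: sorted_wrt_rev)
    with that show False by simp
  qed
  with 1 show ?case unfolding contains_231_iff by auto
next
  case (2 x inp)
  thus ?case by simp
next
  case (3 x inp y stk)
  show ?case
  proof (cases "avoids (x # y # stk) [2, 1]")
    case True
    hence "sorted (x # y # stk)" using contains_21_iff by blast
    with 3(1) True show ?thesis by simp
  next
    case False
    hence "\<not> sorted (x # y # stk)" using contains_21_iff by blast
    hence "y < x" using 3(3) by auto
    have stk: "sorted stk" "\<forall>z\<in>set stk. y \<le> z" using 3(3) by auto
    \<comment> \<open>\<open>y\<close> is output first, so no unread entry may be below it. Such an
      entry would form a 231 with \<open>y\<close> and \<open>x\<close>.\<close>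
    have "sorted (stack_run [2, 1] (x # inp) (y # stk)) \<longleftrightarrow>
        (\<forall>z\<in>set inp. y \<le> z) \<and> avoids (rev stk @ x # inp) [2, 3, 1]"
      using False 3(2)[OF False stk(1)] \<open>y < x\<close> stk(2)
      by (auto simp: set_stack_run)
    also have "\<dots> \<longleftrightarrow> avoids (rev stk @ y # x # inp) [2, 3, 1]"
    proof (intro iffI conjI ballI notI)
      assume R: "(\<forall>z\<in>set inp. y \<le> z) \<and> avoids (rev stk @ x # inp) [2, 3, 1]"
      assume "contains (rev stk @ y # x # inp) [2, 3, 1]"
      then obtain u v w where uvw: "subseq [u, v, w] (rev stk @ y # x # inp)" "w < u" "u < v"
        unfolding contains_231_iff by blast
      then obtain as bs where split: "[u, v, w] = as @ bs"
        "subseq as (rev stk)" "subseq bs (y # x # inp)"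
        by (auto simp: subseq_append_iff)
      have as: "sorted_wrt (\<ge>) as"
        using stk(1) by (intro sorted_wrt_subseq[OF split(2)]) (simp add: sorted_wrt_rev)
      have "\<not> subseq bs (x # inp)"
      proof
        assume "subseq bs (x # inp)"
        hence "subseq [u, v, w] (rev stk @ x # inp)"
          using split(1,2) by (simp add: list_emb_append_mono)
        with R uvw show False using contains_231I by blast
      qed
      with split(3) obtain cs where bs: "bs = y # cs" "subseq cs (x # inp)"
        by (cases bs) (auto split: if_splits)
      have "set as \<subseteq> set stk" "set cs \<subseteq> set (x # inp)"
        using set_subseq[OF split(2)] set_subseq[OF bs(2)] by auto
      hence le: "\<forall>z\<in>set as. y \<le> z" "\<forall>z\<in>set cs. y \<le> z"
        using R \<open>y < x\<close> stk(2) by auto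
      \<comment> \<open>\<open>y\<close> cannot be the 2, since nothing after it is smaller; nor the
        3, since no entry before it is smaller; nor the 1, since the entries before it do not
        ascend.\<close>
      from split(1) consider "u = y" "cs = [v, w]" | "as = [u]" "v = y" | "as = [u, v]"
        unfolding bs by (auto simp: Cons_eq_append_conv)
      thus False using le as uvw(2,3) by cases auto
    next
      fix z assume R: "avoids (rev stk @ y # x # inp) [2, 3, 1]" and "z \<in> set inp"
      hence "subseq [y, x, z] (rev stk @ y # x # inp)"
        by (intro list_emb_append2) (auto simp: subseq_singleton_left)
      with R \<open>y < x\<close> show "y \<le> z" using contains_231I[of y x z] by force
    next
      assume "avoids (rev stk @ y # x # inp) [2, 3, 1]" "contains (rev stk @ x # inp) [2, 3, 1]"
      moreover have "subseq (rev stk @ x # inp) (rev stk @ y # x # inp)"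
        unfolding subseq_append' by (rule list_emb_Cons) (rule subseq_order.order_refl)
      ultimately show False using contains_mono by blast
    qed
    finally show ?thesis by simp
  qed
qed

lemma Sym_iff: "\<pi> \<in> Sym \<longleftrightarrow> \<pi> \<noteq> [] \<and> distinct \<pi> \<and> set \<pi> = {1..length \<pi>}"
  by (auto simp: Sym_def Sym_n_def Suc_le_eq)

lemma stack_op_Sym:
  assumes "\<pi> \<in> Sym"
  shows "stack_op \<tau> \<pi> \<in> Sym"
proof -
  define \<rho> where "\<rho> = stack_op \<tau> \<pi>"
  have eq: "mset \<rho> = mset \<pi>" by (simp add: \<rho>_def stack_op_def mset_stack_run)
  have "length \<rho> = length \<pi>" by (rule mset_eq_length[OF eq])
  hence "\<rho> \<in> Sym" using assms mset_eq_imp_distinct_iff[OF eq] mset_eq_setD[OF eq]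
    unfolding Sym_iff by (metis length_0_conv)
  thus ?thesis by (simp add: \<rho>_def)
qed

lemma sortable_iff: "sortable \<sigma> \<pi> \<longleftrightarrow> \<pi> \<in> Sym \<and> avoids (stack_op \<sigma> \<pi>) [2, 3, 1]"
proof (cases "\<pi> \<in> Sym")
  case True
  define \<rho> where "\<rho> = stack_op [2, 1] (stack_op \<sigma> \<pi>)"
  have "\<rho> \<in> Sym" unfolding \<rho>_def by (intro stack_op_Sym True)
  moreover have "length \<rho> = length \<pi>"
    by (simp add: \<rho>_def stack_op_def length_stack_run)
  ultimately have \<rho>: "distinct \<rho>" "set \<rho> = set [1..<Suc (length \<pi>)]"
    unfolding Sym_iff by (simp_all add: atLeastLessThanSuc_atLeastAtMost del: upt_Suc)
  \<comment> \<open>Within \<open>Sym\<close>, being sorted and being the identity coincide.\<close>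
  have "\<rho> = [1..<Suc (length \<pi>)] \<longleftrightarrow> sorted \<rho>"
    using sorted_distinct_set_unique[OF _ \<rho>(1) _ _ \<rho>(2)] by (metis distinct_upt sorted_upt)
  with True show ?thesis
    by (simp add: sortable_def \<rho>_def stack_op_def[of "[2, 1]"] sorted_stack_run_21_iff
        flip: One_nat_def del: upt_Suc)
qed (simp add: sortable_def)

lemma not_effective_iff:
  "\<not> effective \<sigma> \<longleftrightarrow>
     (\<exists>\<pi>\<in>Sym. avoids (stack_op \<sigma> \<pi>) [2, 3, 1] \<and> contains (stack_op \<sigma> \<pi>) \<sigma>)"
  using stack_op_Sym by (auto simp: effective_def Sorted_def Sort_def sortable_iff Sym_av_def)

section \<open>Consequences of a forced pop\<close>

text \<open>The first alternative covers runs in which no push is refused. The stack is arbitrary so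
  that the induction can follow the pops one at a time.\<close>

lemma stack_run_rev_or_contains_hat:
  assumes "length \<sigma> \<ge> 2" and "avoids stk \<sigma>"
  shows "avoids (rev inp @ stk) \<sigma> \<and> stack_run \<sigma> inp stk = rev inp @ stk
    \<or> contains (stack_run \<sigma> inp stk) (hat \<sigma>)"
  using assms
proof (induction \<sigma> inp stk rule: stack_run.induct)
  case (2 \<sigma> x inp)
  have "avoids [x] \<sigma>" using 2(2) contains_length by fastforce
  with 2 show ?case by simp
next
  case (3 \<sigma> x inp y stk)
  show ?case
  proof (cases "avoids (x # y # stk) \<sigma>")
    case True
    with 3 show ?thesis by simp
  next
    case False
    have stk: "avoids stk \<sigma>" using 3(4) contains_mono[of stk \<sigma> "y # stk"] by auto
    have run: "stack_run \<sigma> (x # inp) (y # stk) = y # stack_run \<sigma> (x # inp) stk"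
      using False by simp
    have "contains (y # stack_run \<sigma> (x # inp) stk) (hat \<sigma>)"
    proof (cases "avoids (x # stk) \<sigma>")
      case True
      from False obtain ys where ys: "subseq ys (x # y # stk)" "order_iso ys \<sigma>"
        by (auto simp: contains_def)
      \<comment> \<open>Neither \<open>x\<close> nor \<open>y\<close> can be missing from the
        occurrence, so they are its first two entries.\<close>
      have "\<not> subseq ys (y # stk)" "\<not> subseq ys (x # stk)"
        using ys(2) True 3(4) by (auto simp: contains_def)
      with ys(1) obtain zs where zs: "ys = x # y # zs" "subseq zs stk"
        by (cases ys rule: hat.cases) (auto split: if_splits)
      obtain a b \<tau> where \<sigma>: "\<sigma> = a # b # \<tau>" using ys(2) zs(1)
        by (cases \<sigma> rule: hat.cases) (auto simp: order_iso_def)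
      have "order_iso (y # x # zs) (hat \<sigma>)"
        using ys(2) order_iso_swap unfolding zs(1) \<sigma> by simp
      moreover have "stack_run \<sigma> (x # inp) stk = stack_run \<sigma> inp (x # stk)"
        using True by (cases stk) auto
      hence "subseq (x # stk) (stack_run \<sigma> (x # inp) stk)"
        using subseq_stack_run by metis
      hence "subseq (y # x # zs) (y # stack_run \<sigma> (x # inp) stk)"
        using zs(2) by (meson subseq_Cons2 subseq_order.trans)
      ultimately show ?thesis by (auto simp: contains_def)
    next
      case nav: False
      \<comment> \<open>Here \<open>x\<close> is still refused after the pop of \<open>y\<close>.
        This excludes the first alternative of the induction hypothesis.\<close>
      have "contains (rev (x # inp) @ stk) \<sigma>"
        using nav contains_mono[of "x # stk" \<sigma> "rev (x # inp) @ stk"] by auto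
      with 3(2)[OF False 3(3) stk] have "contains (stack_run \<sigma> (x # inp) stk) (hat \<sigma>)" by blast
      thus ?thesis using contains_mono by blast
    qed
    with run show ?thesis by simp
  qed
qed simp

text \<open>Suppose \<open>x\<close> forces out \<open>y\<close>, and \<open>y # cs\<close> is an
  occurrence of \<open>\<sigma>\<close> in the output. The refused push gives an occurrence
  \<open>x # ws\<close>. As \<open>\<sigma>\<close> starts with its minimum, the smaller of
  \<open>x\<close> and \<open>y\<close> can head the other's occurrence: \<open>x # cs\<close> would
  appear later in the output, \<open>y # ws\<close> in a stack that avoids
  \<open>\<sigma>\<close>.\<close>

lemma avoids_stack_run:
  assumes "\<sigma> = a # b # \<tau>" and "\<forall>v\<in>set (b # \<tau>). a < v" and "avoids stk \<sigma>"
    and "avoids (stack_run \<sigma> inp stk) [2, 3, 1]"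
  shows "avoids (stack_run \<sigma> inp stk) \<sigma>"
  using assms
proof (induction \<sigma> inp stk rule: stack_run.induct)
  case (2 \<sigma> x inp)
  have "avoids [x] \<sigma>" using 2(2) contains_length[of "[x]" \<sigma>] by auto
  with 2 show ?case by simp
next
  case (3 \<sigma> x inp y stk)
  show ?case
  proof (cases "avoids (x # y # stk) \<sigma>")
    case True
    with 3 show ?thesis by simp
  next
    case False
    define R where "R = stack_run \<sigma> (x # inp) stk"
    have run: "stack_run \<sigma> (x # inp) (y # stk) = y # R"
      using False by (simp add: R_def)
    have av: "avoids (y # R) [2, 3, 1]" using 3(6) run by simp
    have "avoids stk \<sigma>" using 3(5) contains_mono[of stk \<sigma> "y # stk"] by auto
    hence R: "avoids R \<sigma>"
      using 3(2)[OF False 3(3,4)] av contains_mono[of R _ "y # R"] unfolding R_def by auto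
    have \<sigma>: "order_iso (u # us) \<sigma> \<longleftrightarrow> order_iso us (b # \<tau>) \<and> (\<forall>v\<in>set us. u < v)" for u us
      using order_iso_Cons_min[OF 3(4)] 3(3) by simp
    have Cons: "\<exists>u us'. us = u # us'" if "order_iso us \<sigma>" for us
      using that 3(3) by (cases us) (auto simp: order_iso_def)
    have "avoids (y # R) \<sigma>"
    proof
      assume "contains (y # R) \<sigma>"
      then obtain us where us: "subseq us (y # R)" "order_iso us \<sigma>" by (auto simp: contains_def)
      moreover have "\<not> subseq us R" using us(2) R by (auto simp: contains_def)
      ultimately obtain cs where cs: "us = y # cs" "subseq cs R"
        using Cons[OF us(2)] by (auto split: if_splits)
      from False obtain vs where vs: "subseq vs (x # y # stk)" "order_iso vs \<sigma>"
        by (auto simp: contains_def)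
      moreover have "\<not> subseq vs (y # stk)" using vs(2) 3(5) by (auto simp: contains_def)
      ultimately obtain ws where ws: "vs = x # ws" "subseq ws (y # stk)"
        using Cons[OF vs(2)] by (auto split: if_splits)
      have iso: "order_iso cs (b # \<tau>)" "\<forall>v\<in>set cs. y < v"
        "order_iso ws (b # \<tau>)" "\<forall>v\<in>set ws. x < v"
        using us(2) vs(2) unfolding cs ws \<sigma> by auto
      show False
      proof (cases "x < y")
        case True
        have "x \<in> set R" by (simp add: R_def set_stack_run)
        then obtain R1 R2 where R12: "R = R1 @ x # R2" by (auto dest: split_list)
        txt \<open>An entry of \<^term>\<open>cs\<close> output before \<^term>\<open>x\<close> would form a 231 with \<^term>\<open>y\<close> and \<^term>\<open>x\<close>.
          So \<^term>\<open>x\<close> can replace \<^term>\<open>y\<close> in the occurrence.\<close>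
        obtain c cs' where c: "cs = c # cs'" using iso(1) by (cases cs) (auto simp: order_iso_def)
        have "c \<notin> set R1"
        proof
          assume "c \<in> set R1"
          hence "subseq ([c] @ [x]) (R1 @ x # R2)"
            by (intro list_emb_append_mono) (auto simp: subseq_singleton_left)
          hence "subseq [y, c, x] (y # R)" by (simp add: R12)
          moreover have "y < c" using iso(2) c by simp
        ultimately show False using True av contains_231I by blast
        qed
        hence "subseq cs (x # R2)" using cs(2) unfolding c R12 by (rule subseq_append_not_in[rotated])
        hence "subseq cs R2" using iso(2) True unfolding c by (auto split: if_splits)
        hence "subseq (x # cs) R" unfolding R12 by (intro list_emb_append2) auto
        moreover have "order_iso (x # cs) \<sigma>" using iso True \<sigma> by auto
        ultimately show False using R by (auto simp: contains_def)
      next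
        case False
        \<comment> \<open>Here \<open>y\<close> is at most \<open>x\<close>, hence below all of
          \<open>ws\<close>. So \<open>ws\<close> lies in \<open>stk\<close>, and \<open>y\<close>
          can replace \<open>x\<close>.\<close>
        hence "y \<notin> set ws" using iso(4) by auto
        hence "subseq (y # ws) (y # stk)"
          using ws(2) by (cases ws) (auto split: if_splits)
        moreover have "order_iso (y # ws) \<sigma>" using iso False \<sigma> by auto
        ultimately show False using 3(5) by (auto simp: contains_def)
      qed
    qed
    thus ?thesis using run by simp
  qed
qed simp

section \<open>Characterisation of effective permutations\<close>

lemma not_effective_imp_hat_eq_one_oplus:
  assumes Sym: "\<sigma> \<in> Sym" and len: "length \<sigma> \<ge> 2" and "\<not> effective \<sigma>"
  shows "\<exists>\<alpha>\<in>Sym_av [2, 3, 1]. hat \<sigma> = one_oplus \<alpha>"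
proof -
  obtain a b \<tau> where \<sigma>: "\<sigma> = a # b # \<tau>" using len by (cases \<sigma> rule: hat.cases) auto
  from assms(3) obtain \<rho> \<pi> where \<rho>: "\<rho> = stack_run \<sigma> \<pi> []" "avoids \<rho> [2, 3, 1]" "contains \<rho> \<sigma>"
    by (auto simp: not_effective_iff stack_op_def)
  have Nil: "avoids [] \<sigma>" using contains_length[of "[]" \<sigma>] by (auto simp: \<sigma>)
  from stack_run_rev_or_contains_hat[OF len Nil, of \<pi>] have "contains \<rho> (hat \<sigma>)"
    using \<rho>(1,3) by auto
  hence av: "avoids (a # b # \<tau>) [2, 3, 1]" "avoids (b # a # \<tau>) [2, 3, 1]"
    using \<rho>(2,3) contains_trans \<sigma> by auto
  have set: "set \<sigma> = {1..length \<sigma>}" and dist: "distinct \<sigma>" using Sym by (auto simp: Sym_iff)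
  have pos: "\<forall>v\<in>set (a # b # \<tau>). 1 \<le> v" using set by (simp flip: \<sigma>)
  have dist': "distinct (a # b # \<tau>)" using dist by (simp only: \<sigma>)
  have "1 \<in> set \<sigma>" unfolding set using len by simp
  moreover have "a \<noteq> 1"
  proof
    assume "a = 1"
    hence "\<forall>v\<in>set (b # \<tau>). a < v" using pos dist' by (auto simp: le_less)
    from avoids_stack_run[OF \<sigma> this Nil, of \<pi>] \<rho> show False by simp
  qed
  moreover have "1 \<notin> set \<tau>"
  proof
    assume 1: "1 \<in> set \<tau>"
    \<comment> \<open>One of \<open>\<sigma>\<close> and \<open>hat \<sigma>\<close> has
      \<open>a\<close> and \<open>b\<close> in ascending order, and the 1 after them completes a
      231.\<close>
    have "1 < a" "1 < b" "a \<noteq> b" using 1 pos dist' by (auto simp: le_less)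
    moreover have "subseq [a, b, 1] (a # b # \<tau>)" "subseq [b, a, 1] (b # a # \<tau>)"
      using 1 by (simp_all add: subseq_singleton_left)
    ultimately show False using av contains_231I by (metis nat_neq_iff)
  qed
  ultimately have b: "b = 1" by (auto simp: \<sigma>)
  \<comment> \<open>This undoes the shift in \<open>one_oplus\<close>. The truncated subtraction is
    exact, since these entries are at least 2.\<close>
  define \<alpha> where "\<alpha> = map (\<lambda>v. v - 1) (a # \<tau>)"
  have set_a: "set (a # \<tau>) = {2..length \<sigma>}"
  proof -
    have "set (a # \<tau>) = set \<sigma> - {1}" using dist' unfolding \<sigma> b by auto
    also have "\<dots> = {2..length \<sigma>}" unfolding set by auto
    finally show ?thesis .
  qed
  have Suc_\<alpha>: "map Suc \<alpha> = a # \<tau>"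
  proof -
    have "map Suc \<alpha> = map (\<lambda>v. v) (a # \<tau>)"
      unfolding \<alpha>_def map_map using set_a by (intro map_cong) auto
    thus ?thesis by simp
  qed
  have "Suc ` set \<alpha> = set (a # \<tau>)" using arg_cong[OF Suc_\<alpha>, of set] by simp
  also have "\<dots> = {2..Suc (length \<alpha>)}" unfolding set_a by (simp add: \<sigma> \<alpha>_def)
  also have "\<dots> = Suc ` {1..length \<alpha>}" by (simp add: numeral_2_eq_2)
  finally have "Suc ` set \<alpha> = Suc ` {1..length \<alpha>}" .
  hence "set \<alpha> = {1..length \<alpha>}" by (simp only: inj_image_eq_iff inj_Suc)
  moreover have "distinct (map Suc \<alpha>)" using dist' unfolding Suc_\<alpha> by simp
  ultimately have "\<alpha> \<in> Sym" using Suc_\<alpha> unfolding Sym_iff distinct_map by blast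
  moreover have "avoids \<alpha> [2, 3, 1]"
  proof
    assume "contains \<alpha> [2, 3, 1]"
    moreover have "order_iso \<alpha> (map Suc \<alpha>)" by (auto simp: order_iso_def)
    ultimately have "contains (a # \<tau>) [2, 3, 1]" unfolding Suc_\<alpha> by (rule contains_order_iso)
    moreover have "subseq (a # \<tau>) (b # a # \<tau>)" by (rule list_emb_Cons) simp
    ultimately show False using av(2) contains_mono by blast
  qed
  moreover have "hat \<sigma> = one_oplus \<alpha>" by (simp add: \<sigma> b one_oplus_def Suc_\<alpha>)
  ultimately show ?thesis by (auto simp: Sym_av_def)
qed

section \<open>Sufficiency of the condition\<close>

lemma hat_eq_one_oplus_imp_not_effective:
  assumes Sym: "\<sigma> \<in> Sym" and len: "length \<sigma> \<ge> 2"
    and \<alpha>: "\<alpha> \<in> Sym_av [2, 3, 1]" and hat: "hat \<sigma> = one_oplus \<alpha>"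
  shows "\<not> effective \<sigma>"
proof -
  obtain a s where \<sigma>: "\<sigma> = a # 1 # s" and Suc_\<alpha>: "map Suc \<alpha> = a # s"
    using len hat by (cases \<sigma> rule: hat.cases) (auto simp: one_oplus_def)
  define k where "k = length \<sigma>"
  have set: "set (a # 1 # s) = {1..k}" and dist: "distinct (a # 1 # s)"
    using Sym by (auto simp: Sym_iff \<sigma> k_def simp del: set_simps)
  have gt1: "\<forall>v\<in>set (a # s). 1 < v"
  proof
    fix v assume "v \<in> set (a # s)"
    hence "v \<noteq> 1" "v \<in> {1..k}" using dist unfolding set[symmetric] by auto
    thus "1 < v" by simp
  qed
  have av: "avoids (a # s) [2, 3, 1]"
  proof
    assume "contains (a # s) [2, 3, 1]"
    moreover have "order_iso (a # s) \<alpha>" unfolding Suc_\<alpha>[symmetric] by (auto simp: order_iso_def)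
    ultimately have "contains \<alpha> [2, 3, 1]" by (rule contains_order_iso)
    thus False using \<alpha> by (auto simp: Sym_av_def)
  qed
  \<comment> \<open>As \<open>a # s\<close> avoids 231, no entry below \<open>a\<close> follows an
    entry of \<open>s\<close> above \<open>a\<close>, so this cut separates the two kinds.\<close>
  define s1 s2 where "s1 = takeWhile (\<lambda>v. v < a) s" and "s2 = dropWhile (\<lambda>v. v < a) s"
  have s: "s = s1 @ s2" by (simp add: s1_def s2_def)
  have s1: "\<forall>v\<in>set s1. v < a" by (auto simp: s1_def dest: set_takeWhileD)
  have s2: "\<forall>v\<in>set s2. a < v"
  proof (cases s2)
    case (Cons b s2')
    have "\<not> b < a" using Cons hd_dropWhile[of "\<lambda>v. v < a" s] by (simp add: s2_def)
    moreover have "b \<in> set s" using Cons s by auto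
    ultimately have b: "a < b" using dist by (metis distinct.simps(2) linorder_neqE_nat list.set_intros(2))
    have "a < v" if v: "v \<in> set s2'" for v
    proof (rule ccontr)
      assume "\<not> a < v"
      moreover have "v \<noteq> a" using dist v by (auto simp: s Cons)
      moreover have "subseq ([] @ [b, v]) (s1 @ s2)"
        unfolding Cons using v by (intro list_emb_append_mono) (auto simp: subseq_singleton_left)
      hence "subseq [a, b, v] (a # s)" by (simp add: s)
      ultimately show False using av b contains_231I[of a b v] by simp
    qed
    with b Cons show ?thesis by auto
  qed simp
  \<comment> \<open>The least value of \<open>a # s\<close> is 2, so a shift by \<open>a - 1\<close>
    puts the copy just above \<open>a\<close> and leaves no gap among the values of
    \<open>\<pi>\<close>.\<close>
  define c where "c = a - 1"
  define f where "f v = v + c" for v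
  define x where "x = f a"
  define \<pi> where "\<pi> = rev (map f s) @ [a] @ [x] @ rev s1 @ [1]"
  define \<rho> where "\<rho> = a # 1 # s1 @ x # map f s"
  have a: "1 < a" using gt1 by simp
  have fgt: "\<forall>v\<in>set (x # map f s). a < v" using gt1 a by (auto simp: x_def f_def c_def)
  have len\<sigma>: "length \<sigma> = length s + 2" by (simp add: \<sigma>)
  have short: "avoids xs \<sigma>" if "length xs < length \<sigma>" for xs
    using that contains_length[of xs \<sigma>] by linarith

  have av_\<rho>: "avoids \<rho> [2, 3, 1]"
  proof -
    have "avoids (a # 1 # s1) [2, 3, 1]"
    proof
      assume "contains (a # 1 # s1) [2, 3, 1]"
      then obtain u v w where uvw: "subseq [u, v, w] (a # 1 # s1)" "w < u" "u < v"
        unfolding contains_231_iff by blast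
      have "u \<in> set (a # 1 # s1)" "v \<in> set (a # 1 # s1)" "w \<in> set (a # 1 # s1)"
        using set_subseq[OF uvw(1)] by auto
      \<comment> \<open>\<open>a\<close> is the maximum and 1 the minimum of this block, so neither
        can be the 2 of a 231.\<close>
      hence "u \<noteq> a" "u \<noteq> 1" using uvw(2,3) s1 a gt1 s by fastforce+
      hence "subseq [u, v, w] s1" using uvw(1) by (simp split: if_splits)
      hence "subseq [u, v, w] (a # s)" unfolding s by (intro list_emb_Cons subseq_rev_drop_many)
      thus False using av uvw(2,3) contains_231I by blast
    qed
    moreover have "avoids (x # map f s) [2, 3, 1]"
    proof
      assume "contains (x # map f s) [2, 3, 1]"
      moreover have "order_iso (map f (a # s)) (a # s)"
        by (intro order_iso_map) (auto simp: strict_mono_on_def f_def)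
      ultimately show False using av contains_order_iso unfolding x_def by fastforce
    qed
    moreover have "\<forall>u\<in>set (a # 1 # s1). u \<le> a" using s1 a by auto
    hence "\<forall>u\<in>set (a # 1 # s1). \<forall>v\<in>set (x # map f s). u < v" using fgt le_less_trans by blast
    ultimately show ?thesis unfolding \<rho>_def
      using avoids_231_append[of "a # 1 # s1" "x # map f s"] by simp
  qed

  have contains_\<rho>: "contains \<rho> \<sigma>"
  proof -
    \<comment> \<open>\<open>g\<close> fixes the values up to \<open>a\<close> and lifts the others
      to the copy; in \<open>\<sigma>\<close> only the entries of \<open>s2\<close> are
      lifted.\<close>
    define g where "g v = (if v \<le> a then v else v + c)" for v
    have "order_iso (map g \<sigma>) \<sigma>"
      by (intro order_iso_map) (auto simp: strict_mono_on_def g_def)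
    moreover have "map g \<sigma> = a # 1 # s1 @ map f s2"
      using s1 s2 a by (auto simp: \<sigma> s g_def f_def intro!: map_idI)
    moreover have "subseq (map f s2) (x # map f s)"
      unfolding s by (intro list_emb_Cons) (simp add: list_emb_append2)
    hence "subseq (a # 1 # s1 @ map f s2) \<rho>" unfolding \<rho>_def by (simp add: subseq_append')
    ultimately show ?thesis by (auto simp: contains_def)
  qed

  \<comment> \<open>This is why \<open>x\<close> is refused: \<open>a\<close> takes the role of 1,
    \<open>x\<close> the role of \<open>a\<close>, and the rest that of \<open>s\<close>.\<close>
  have bad: "contains (x # a # map f s) \<sigma>"
  proof -
    have "order_iso (map f (a # s)) (a # s)"
      by (intro order_iso_map) (auto simp: strict_mono_on_def f_def)
    hence "order_iso (a # x # map f s) (1 # a # s)"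
      using order_iso_Cons_min[OF gt1] fgt by (simp add: x_def)
    hence "order_iso (x # a # map f s) \<sigma>" unfolding \<sigma> by (rule order_iso_swap)
    thus ?thesis by (auto simp: contains_def)
  qed

  \<comment> \<open>The first entry of \<open>\<sigma>\<close> is the value \<open>a\<close>, so an
    occurrence among positive numbers starts with an entry of at least \<open>a\<close>. This rules
    out a start in \<open>1 # s1\<close>, and what remains is one entry too short.\<close>
  have av_final: "avoids (1 # s1 @ x # map f s) \<sigma>"
  proof
    assume "contains (1 # s1 @ x # map f s) \<sigma>"
    then obtain ys where ys: "subseq ys ((1 # s1) @ x # map f s)" "order_iso ys \<sigma>"
      by (auto simp: contains_def)
    then obtain u us where u: "ys = u # us" by (cases ys) (auto simp: order_iso_def \<sigma>)
    have "\<forall>v\<in>set ys. 1 \<le> v"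
    proof -
      have "set ys \<subseteq> set ((1 # s1) @ x # map f s)" by (rule set_subseq[OF ys(1)])
      moreover have "1 \<le> v" if "v \<in> set ((1 # s1) @ x # map f s)" for v
      proof -
        have "\<forall>v\<in>set s1. 1 < v" using gt1 by (simp add: s)
        moreover have "\<forall>v\<in>set (x # map f s). 1 < v" using fgt a less_trans by blast
        ultimately show ?thesis using that by (auto simp: less_imp_le)
      qed
      ultimately show ?thesis by blast
    qed
    hence "a \<le> u" using order_iso_perm_hd_le[of u us a "1 # s" k] ys(2) set unfolding u \<sigma> by blast
    hence "u \<notin> set (1 # s1)" using s1 a by auto
    with ys(1) have "subseq ys (x # map f s)" unfolding u by (rule subseq_append_not_in)
    hence "length ys \<le> length (x # map f s)" by (rule list_emb_length)
    moreover have "length ys = length \<sigma>" using ys(2) by (simp add: order_iso_def)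
    ultimately show False using len\<sigma> by simp
  qed

  have run: "stack_op \<sigma> \<pi> = \<rho>"
  proof -
    have "stack_op \<sigma> \<pi> = stack_run \<sigma> ((rev (map f s) @ [a]) @ [x] @ rev s1 @ [1]) []"
      by (simp add: stack_op_def \<pi>_def)
    \<comment> \<open>This stack has one entry less than \<open>\<sigma>\<close>, so nothing is
      refused until \<open>x\<close> arrives.\<close>
    also have "\<dots> = stack_run \<sigma> ([x] @ rev s1 @ [1]) (a # map f s)"
      using short[of "a # map f s"] len\<sigma> by (subst stack_run_push) simp_all
    also have "\<dots> = a # stack_run \<sigma> ([x] @ rev s1 @ [1]) (map f s)" using bad by simp
    \<comment> \<open>The list in \<open>av_final\<close> is the stack after the last push, so every
      remaining push succeeds.\<close>
    also have "stack_run \<sigma> ([x] @ rev s1 @ [1]) (map f s) = 1 # s1 @ x # map f s"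
      using stack_run_push[of "[x] @ rev s1 @ [1]" "map f s" \<sigma> "[]"] av_final by simp
    finally show ?thesis by (simp add: \<rho>_def)
  qed

  have "\<pi> \<in> Sym"
  proof -
    \<comment> \<open>Since \<open>s2\<close> lies above \<open>a\<close>, the entries
      \<open>a\<close>, 1 and \<open>s1\<close> are all the values up to \<open>a\<close>.\<close>
    have "insert a (insert 1 (set s1)) = {v \<in> set (a # 1 # s). v \<le> a}"
      using s1 s2 a by (auto simp: s)
    also have "\<dots> = {1..a}"
    proof -
      have "a \<le> k" using set by auto
      thus ?thesis unfolding set by auto
    qed
    finally have low: "insert a (insert 1 (set s1)) = {1..a}" .
    \<comment> \<open>The copy of \<open>a # s\<close> fills the interval that starts right after
      \<open>a\<close>.\<close>
    have "set (a # s) = set (a # 1 # s) - {1}" using dist by auto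
    also have "\<dots> = {2..k}" unfolding set by auto
    finally have "insert x (f ` set s) = f ` {2..k}" by (simp add: x_def flip: image_insert)
    moreover have "f ` {2..k} = {2 + c..k + c}" unfolding f_def by (rule image_add_atLeastAtMost')
    ultimately have high: "insert x (f ` set s) = {a + 1..k + c}"
      using a by (simp add: c_def)
    have set_\<pi>: "set \<pi> = {1..k + c}"
    proof -
      have "set \<pi> = insert a (insert 1 (set s1)) \<union> insert x (f ` set s)" by (auto simp: \<pi>_def)
      also have "\<dots> = {1..k + c}" unfolding low high using len by (auto simp: c_def k_def)
      finally show ?thesis .
    qed
    have "distinct (x # map f s)" using dist by (auto simp: x_def f_def distinct_map inj_on_def)
    moreover have "distinct (a # 1 # s1)" using dist by (auto simp: s)
    moreover have "set (a # 1 # s1) \<inter> set (x # map f s) = {}" using low high by auto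
    ultimately have "distinct ((a # 1 # s1) @ x # map f s)" by (simp only: distinct_append)
    hence "distinct \<pi>" unfolding \<pi>_def by auto
    with set_\<pi> have "length \<pi> = k + c" by (metis card_atLeastAtMost diff_Suc_1 distinct_card One_nat_def)
    with set_\<pi> \<open>distinct \<pi>\<close> show ?thesis by (simp add: Sym_iff) (auto simp: \<pi>_def)
  qed
  with run av_\<rho> contains_\<rho> show ?thesis unfolding not_effective_iff by blast
qed

theorem corollary11:
  fixes \<sigma> :: "nat list"
  assumes "\<sigma> \<in> Sym" and "length \<sigma> \<ge> 2"
  shows "\<not> effective \<sigma> \<longleftrightarrow> (\<exists>\<alpha> \<in> Sym_av [2, 3, 1]. hat \<sigma> = one_oplus \<alpha>)"
  using not_effective_imp_hat_eq_one_oplus[OF assms]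
    hat_eq_one_oplus_imp_not_effective[OF assms] by blast

end
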